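(* Let $\delta^{\mathrm{LPL}}\in\mathbb{R}^C$ be a logit perturbation applied in Logit Perturbation Learning (LPL), so that the perturbed loss of a sample $(x_i,y_i)$ of class $c=y_i$ is $l(u_i+\delta^{\mathrm{LPL}},y_i)$, where $u_i=f(x_i;W)$. Then the resulting change in the parameter gradient is, under first-order approximation, $$\Delta g_i=\nabla_W l(u_i+\delta^{\mathrm{LPL}},y_i)-\nabla_W l(u_i,y_i)\approx H_i\,\delta^{\mathrm{LPL}},$$ where $H_i=\frac{\partial^2 l}{\partial W\,\partial u_i}\in\mathbb{R}^{|W|\times C}$ is the cross-derivative. By the chain rule, $H_i=J_i\,\frac{\partial^2 l}{\partial u_i^2}$, so $$\Delta g_i\approx J_i\,\delta_c^h,\qquad \delta_c^h=\frac{\partial^2 l}{\partial u_i^2}\,\delta^{\mathrm{LPL}}.$$ Thus LPL induces the logit gradient perturbation $\delta_c^h=\frac{\partial^2 l}{\partial u_i^2}\,\delta^{\mathrm{LPL}}$, which is a specific structured form of the class-level logit gradient perturbation $\delta_c^h$ used in Learning to Perturb Gradients (LPG); LPG generalizes this by allowing arbitrary $\delta_c^h\in\mathbb{R}^C$.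
   Context: Consider a $C$-class classification problem with training samples $(x_i,y_i)$, $y_i\in\{1,\dots,C\}$, and let $S_c=\{x_i: y_i=c\}$ be the set of samples of class $c$. A network with parameters $W$ ($|W|$ denotes the number of parameters) maps $x_i$ to logits $u_i=f(x_i;W)\in\mathbb{R}^C$. The loss is the cross-entropy $l(u_i,y_i)=-\log p_{y_i}$ with $p_{y_i}=\exp(u_{i,y_i})/\sum_{j=1}^C\exp(u_{i,j})$. The parameter gradient is $g_i=\nabla_W l(f(x_i;W),y_i)\in\mathbb{R}^{|W|}$, the logit gradient is $h_i=\frac{\partial l}{\partial u_i}\in\mathbb{R}^C$, and $J_i=\frac{\partial u_i}{\partial W}\in\mathbb{R}^{|W|\times C}$ is the Jacobian, arranged so that the chain rule reads $g_i=J_i h_i$. The matrix $\frac{\partial^2 l}{\partial u_i^2}\in\mathbb{R}^{C\times C}$ is the Hessian of the loss with respect to the logits at $u_i$, and $H_i=\frac{\partial^2 l}{\partial W\,\partial u_i}$ is the matrix of derivatives with respect to $W$ of the components of the logit gradient. LPL replaces the loss $l(u_i,y_i)$ by $l(u_i+\delta^{\mathrm{LPL}},y_i)$. LPG perturbs logit gradients at the class level: for each class $c$ there is a vector $\delta_c^h\in\mathbb{R}^C$, shared by all samples of the class, and the logit gradient is replaced by $\tilde h_i=h_i+\delta_c^h$ for all $x_i\in S_c$; the resulting perturbation of the parameter gradient of sample $x_i$ is $J_i\,\delta_c^h$. *)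

theory Defs
  imports "HOL-Analysis.Analysis" "HOL-Library.Landau_Symbols"
begin

text \<open>
  Classes are the elements of a finite type \<open>'c\<close> with \<open>C = CARD('c)\<close>, and parameters live in
  \<open>real ^ 'p\<close> with \<open>|W| = CARD('p)\<close>. For a fixed input, a network is seen as the map
  \<open>\<phi> :: real ^ 'p \<Rightarrow> real ^ 'c\<close> from parameters to logits; \<open>k\<close> is the label.
\<close>

definition softmax :: "real ^ 'c \<Rightarrow> real ^ 'c" where
  "softmax u = (\<chi> k. exp (u $ k) / (\<Sum>j\<in>UNIV. exp (u $ j)))"

definition cross_entropy :: "real ^ 'c \<Rightarrow> 'c \<Rightarrow> real" where
  "cross_entropy u k = - ln (softmax u $ k)"

text \<open>Meaningful only where the gradient exists; see \<open>gradient_eqI\<close>.\<close>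

definition gradient :: "('a::real_inner \<Rightarrow> real) \<Rightarrow> 'a \<Rightarrow> 'a" where
  "gradient F a = (THE D. GDERIV F a :> D)"

lemma gradient_eqI:
  assumes "GDERIV F a :> D"
  shows "gradient F a = D"
  unfolding gradient_def
proof (rule the_equality)
  fix D' assume "GDERIV F a :> D'"
  then have "(\<lambda>h. inner h D') = (\<lambda>h. inner h D)"
    using assms unfolding gderiv_def by (rule has_derivative_unique)
  then show "D' = D"
    by (metis vector_eq_ldot)
qed (rule assms)

definition logit_gradient :: "real ^ 'c \<Rightarrow> 'c \<Rightarrow> real ^ 'c" where
  "logit_gradient u k = gradient (\<lambda>v. cross_entropy v k) u"

definition param_gradient :: "(real ^ 'p \<Rightarrow> real ^ 'c) \<Rightarrow> 'c \<Rightarrow> real ^ 'p \<Rightarrow> real ^ 'p" where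
  "param_gradient \<phi> k W = gradient (\<lambda>V. cross_entropy (\<phi> V) k) W"

text \<open>
  The library's \<open>jacobian\<close> has one row per output component. Here rows are indexed by the
  parameters, so that the chain rule reads \<open>g = J *v h\<close>; hence the transpositions below.
\<close>

definition logit_jacobian :: "(real ^ 'p \<Rightarrow> real ^ 'c) \<Rightarrow> real ^ 'p \<Rightarrow> real ^ 'c ^ 'p" where
  "logit_jacobian \<phi> W = transpose (jacobian \<phi> (at W))"

definition logit_hessian :: "real ^ 'c \<Rightarrow> 'c \<Rightarrow> real ^ 'c ^ 'c" where
  "logit_hessian u k = jacobian (\<lambda>v. logit_gradient v k) (at u)"

definition cross_derivative ::
    "(real ^ 'p \<Rightarrow> real ^ 'c) \<Rightarrow> 'c \<Rightarrow> real ^ 'p \<Rightarrow> real ^ 'c ^ 'p" where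
  "cross_derivative \<phi> k W = transpose (jacobian (\<lambda>V. logit_gradient (\<phi> V) k) (at W))"

text \<open>The perturbation \<open>\<delta>\<close> does not depend on the parameters when differentiating.\<close>

definition lpl_change ::
    "(real ^ 'p \<Rightarrow> real ^ 'c) \<Rightarrow> 'c \<Rightarrow> real ^ 'p \<Rightarrow> real ^ 'c \<Rightarrow> real ^ 'p" where
  "lpl_change \<phi> k W \<delta> =
     gradient (\<lambda>V. cross_entropy (\<phi> V + \<delta>) k) W - param_gradient \<phi> k W"

definition lpl_induced :: "real ^ 'c \<Rightarrow> 'c \<Rightarrow> real ^ 'c \<Rightarrow> real ^ 'c" where
  "lpl_induced u k \<delta> = logit_hessian u k *v \<delta>"

text \<open>
  Training data are given by inputs \<open>x\<close> and labels \<open>y\<close> over an index set \<open>I\<close>. Classes are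
  sets of indices, as the same input may occur more than once.
\<close>

definition class_samples :: "'i set \<Rightarrow> ('i \<Rightarrow> 'c) \<Rightarrow> 'c \<Rightarrow> 'i set" where
  "class_samples I y c = {i \<in> I. y i = c}"

text \<open>
  An LPG perturbation is a family \<open>\<Delta> :: 'c \<Rightarrow> real ^ 'c\<close> with one arbitrary vector per class,
  shared by all samples of that class.
\<close>

definition lpg_logit_gradient ::
    "('x \<Rightarrow> real ^ 'p \<Rightarrow> real ^ 'c) \<Rightarrow> ('i \<Rightarrow> 'x) \<Rightarrow> ('i \<Rightarrow> 'c) \<Rightarrow> real ^ 'p \<Rightarrow>
     ('c \<Rightarrow> real ^ 'c) \<Rightarrow> 'i \<Rightarrow> real ^ 'c" where
  "lpg_logit_gradient f x y W \<Delta> i = logit_gradient (f (x i) W) (y i) + \<Delta> (y i)"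

definition lpg_change ::
    "('x \<Rightarrow> real ^ 'p \<Rightarrow> real ^ 'c) \<Rightarrow> ('i \<Rightarrow> 'x) \<Rightarrow> ('i \<Rightarrow> 'c) \<Rightarrow> real ^ 'p \<Rightarrow>
     ('c \<Rightarrow> real ^ 'c) \<Rightarrow> 'i \<Rightarrow> real ^ 'p" where
  "lpg_change f x y W \<Delta> i =
     logit_jacobian (f (x i)) W *v lpg_logit_gradient f x y W \<Delta> i
       - param_gradient (f (x i)) (y i) W"

end

theory Submission
  imports Defs
begin

text \<open>
  By the chain rule, \<open>lpl_change \<phi> k W \<delta> = J (h (u + \<delta>) - h u)\<close>, where \<open>u = \<phi> W\<close> and
  \<open>h u = softmax u - axis k 1\<close> is the logit gradient; differentiability of \<open>h\<close> at \<open>u\<close> is the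
  first-order approximation. The Hessian \<open>diag p - p p\<^sup>T\<close>, with \<open>p = softmax u\<close>, is symmetric,
  which turns the transposed chain rule for \<open>h \<circ> \<phi>\<close> into \<open>H = J \<cdot> Hess\<close>. Its columns sum to zero,
  so it is never surjective.
\<close>

lemma sum_exp_pos: "0 < (\<Sum>j\<in>UNIV. exp ((u :: real ^ 'c) $ j))"
  by (rule sum_pos) auto

lemma sum_softmax: "(\<Sum>k\<in>UNIV. softmax (u :: real ^ 'c) $ k) = 1"
  using sum_exp_pos[of u] by (simp add: softmax_def flip: sum_divide_distrib)

lemma cross_entropy_eq:
  "cross_entropy u k = ln (\<Sum>j\<in>UNIV. exp ((u :: real ^ 'c) $ j)) - u $ k"
  using sum_exp_pos[of u] by (simp add: cross_entropy_def softmax_def ln_div)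

text \<open>The partition sum stays as an explicit factor so that it cancels under \<open>ln\<close>
  and in the quotient rule, leaving only \<open>softmax u \<bullet> h\<close>.\<close>

lemma has_derivative_sum_exp:
  "((\<lambda>v. \<Sum>j\<in>UNIV. exp ((v :: real ^ 'c) $ j)) has_derivative
     (\<lambda>h. (\<Sum>j\<in>UNIV. exp (u $ j)) * (softmax u \<bullet> h))) (at u)"
  using sum_exp_pos[of u]
  by (auto intro!: derivative_eq_intros bounded_linear_imp_has_derivative[OF bounded_linear_vec_nth]
      simp: softmax_def inner_vec_def sum_distrib_left fun_eq_iff mult.commute)

lemma gderiv_cross_entropy:
  "GDERIV (\<lambda>v. cross_entropy v k) (u :: real ^ 'c) :> softmax u - axis k 1"
proof -
  have "((\<lambda>v. ln (\<Sum>j\<in>UNIV. exp (v $ j)) - v $ k) has_derivative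
      (\<lambda>h. softmax u \<bullet> h - h $ k)) (at u)"
    using has_derivative_diff[OF has_derivative_ln[OF sum_exp_pos has_derivative_sum_exp]
        bounded_linear_imp_has_derivative[OF bounded_linear_vec_nth], of k u] sum_exp_pos[of u]
    by (simp add: field_simps)
  then show ?thesis
    by (simp add: gderiv_def cross_entropy_eq inner_diff_right inner_axis inner_commute)
qed

lemma logit_gradient_eq: "logit_gradient (u :: real ^ 'c) k = softmax u - axis k 1"
  unfolding logit_gradient_def by (rule gradient_eqI[OF gderiv_cross_entropy])

text \<open>The matrix \<open>diag p - p p\<^sup>T\<close> with \<open>p = softmax u\<close>,
  applied to \<open>h\<close>. As a function it can serve directly as a Frechet derivative.\<close>

definition softmax_derivative :: "real ^ 'c \<Rightarrow> real ^ 'c \<Rightarrow> real ^ 'c" where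
  "softmax_derivative u h = (\<chi> k. softmax u $ k * (h $ k - softmax u \<bullet> h))"

lemma has_derivative_softmax:
  "(softmax has_derivative softmax_derivative u) (at (u :: real ^ 'c))"
proof -
  have "((\<lambda>v. exp (v $ k) / (\<Sum>j\<in>UNIV. exp (v $ j))) has_derivative
      (\<lambda>h. softmax u $ k * (h $ k - softmax u \<bullet> h))) (at u)" for k
  proof -
    let ?Z = "\<lambda>v :: real ^ 'c. \<Sum>j\<in>UNIV. exp (v $ j)"
    have "((\<lambda>v. exp (v $ k)) has_derivative (\<lambda>h. exp (u $ k) * h $ k)) (at u)"
      by (auto intro!: derivative_eq_intros bounded_linear_imp_has_derivative[OF bounded_linear_vec_nth])
    then have "((\<lambda>v. exp (v $ k) / ?Z v) has_derivative
        (\<lambda>h. (exp (u $ k) * h $ k * ?Z u - exp (u $ k) * (?Z u * (softmax u \<bullet> h))) / (?Z u * ?Z u)))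
        (at u)"
      using has_derivative_sum_exp sum_exp_pos[of u]
      by (intro has_derivative_divide') auto
    also have "(\<lambda>h. (exp (u $ k) * h $ k * ?Z u - exp (u $ k) * (?Z u * (softmax u \<bullet> h))) / (?Z u * ?Z u)) =
        (\<lambda>h. exp (u $ k) / ?Z u * (h $ k - softmax u \<bullet> h))"
      using sum_exp_pos[of u] by (auto simp: fun_eq_iff divide_simps) (simp_all add: algebra_simps)
    also have "exp (u $ k) / ?Z u = softmax u $ k"
      by (simp add: softmax_def)
    finally show ?thesis .
  qed
  then show ?thesis
    unfolding softmax_def[abs_def] softmax_derivative_def
    by (subst has_derivative_componentwise_within)
       (auto simp: Basis_vec_def inner_axis softmax_def)
qed

text \<open>The label enters only through the constant \<open>axis k 1\<close>, so every label gives
  the derivative of \<open>softmax\<close>.\<close>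

lemma has_derivative_logit_gradient:
  "((\<lambda>v. logit_gradient v k) has_derivative softmax_derivative u) (at (u :: real ^ 'c))"
  unfolding logit_gradient_eq
  using has_derivative_diff[OF has_derivative_softmax has_derivative_const] by simp

text \<open>\<open>jacobian\<close> represents the derivative as a matrix; uniqueness of derivatives
  then identifies its action with the explicit formula.\<close>

lemma logit_hessian_mult_vec:
  "logit_hessian (u :: real ^ 'c) k *v h = softmax_derivative u h"
proof -
  have "((\<lambda>v. logit_gradient v k) has_derivative (\<lambda>h. logit_hessian u k *v h)) (at u)"
    unfolding logit_hessian_def
    using has_derivative_logit_gradient by (metis differentiableI jacobian_works)
  then show ?thesis
    using has_derivative_unique[OF _ has_derivative_logit_gradient] by metis
qed

lemma transpose_logit_hessian:
  "transpose (logit_hessian (u :: real ^ 'c) k) = logit_hessian u k"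
proof -
  \<comment> \<open>In this expanded form the bilinear form is visibly symmetric in \<open>a\<close>
    and \<open>b\<close>.\<close>
  have *: "softmax_derivative u a \<bullet> b =
      (\<Sum>j\<in>UNIV. softmax u $ j * a $ j * b $ j) - (softmax u \<bullet> a) * (softmax u \<bullet> b)" for a b
    unfolding softmax_derivative_def
    by (simp add: inner_vec_def[of _ b] algebra_simps sum_subtractf sum_distrib_left)
  have sym: "h \<bullet> (logit_hessian u k *v g) = (logit_hessian u k *v h) \<bullet> g" for g h
    unfolding logit_hessian_mult_vec inner_commute[of h] * by (simp add: mult_ac)
  have "(transpose (logit_hessian u k) *v h) \<bullet> g = (logit_hessian u k *v h) \<bullet> g" for g h
    by (simp add: transpose_matrix_vector dot_lmul_matrix sym)
  then have "transpose (logit_hessian u k) *v h = logit_hessian u k *v h" for h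
    using vector_eq_rdot by blast
  then show ?thesis
    by (simp add: matrix_eq)
qed

text \<open>The softmax weights sum to 1, so weighted deviations from the weighted mean
  \<open>softmax u \<bullet> \<delta>\<close> add up to zero. Induced perturbations thus lie in the
  hyperplane of coordinate sum 0, which misses \<open>axis k 1\<close>.\<close>

lemma lpl_induced_range: "range (lpl_induced (u :: real ^ 'c) k) \<subset> UNIV"
proof -
  have "(\<Sum>j\<in>UNIV. lpl_induced u k \<delta> $ j) = 0" for \<delta>
    by (simp add: lpl_induced_def logit_hessian_mult_vec softmax_derivative_def
        right_diff_distrib sum_subtractf sum_softmax inner_vec_def flip: sum_distrib_right)
  moreover have "(\<Sum>j\<in>UNIV. (axis k 1 :: real ^ 'c) $ j) = 1"
    by (simp add: axis_def)
  ultimately have "axis k 1 \<notin> range (lpl_induced u k)"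
    by (metis rangeE zero_neq_one)
  then show ?thesis
    by blast
qed

text \<open>A constant shift of the logits leaves the Jacobian unchanged, so one formula covers both
  terms of \<open>lpl_change\<close>, with \<open>\<delta> = 0\<close> for the unperturbed
  one.\<close>

lemma gradient_cross_entropy_compose:
  fixes \<phi> :: "real ^ 'p \<Rightarrow> real ^ 'c"
  assumes "\<phi> differentiable (at W)"
  shows "gradient (\<lambda>V. cross_entropy (\<phi> V + \<delta>) k) W =
    logit_jacobian \<phi> W *v logit_gradient (\<phi> W + \<delta>) k"
proof (rule gradient_eqI)
  have "((\<lambda>V. \<phi> V + \<delta>) has_derivative (\<lambda>h. jacobian \<phi> (at W) *v h)) (at W)"
    using assms by (auto intro: has_derivative_add_const simp: jacobian_works)
  then have "((\<lambda>V. cross_entropy (\<phi> V + \<delta>) k) has_derivative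
      (\<lambda>h. (jacobian \<phi> (at W) *v h) \<bullet> logit_gradient (\<phi> W + \<delta>) k)) (at W)"
    by (rule has_derivative_compose)
       (use gderiv_cross_entropy in \<open>simp add: gderiv_def logit_gradient_eq\<close>)
  \<comment> \<open>Moving the Jacobian across the inner product transposes it, which turns the
    derivative into a gradient.\<close>
  moreover have "(jacobian \<phi> (at W) *v h) \<bullet> g = h \<bullet> (logit_jacobian \<phi> W *v g)" for h g
    by (metis logit_jacobian_def dot_lmul_matrix transpose_matrix_vector transpose_transpose)
  ultimately show "GDERIV (\<lambda>V. cross_entropy (\<phi> V + \<delta>) k) W :>
      logit_jacobian \<phi> W *v logit_gradient (\<phi> W + \<delta>) k"
    by (simp add: gderiv_def)
qed

lemma param_gradient_eq:
  fixes \<phi> :: "real ^ 'p \<Rightarrow> real ^ 'c"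
  assumes "\<phi> differentiable (at W)"
  shows "param_gradient \<phi> k W = logit_jacobian \<phi> W *v logit_gradient (\<phi> W) k"
  using gradient_cross_entropy_compose[OF assms, of 0] by (simp add: param_gradient_def)

lemma lpl_change_eq:
  fixes \<phi> :: "real ^ 'p \<Rightarrow> real ^ 'c"
  assumes "\<phi> differentiable (at W)"
  shows "lpl_change \<phi> k W \<delta> =
    logit_jacobian \<phi> W *v logit_gradient (\<phi> W + \<delta>) k - logit_jacobian \<phi> W *v logit_gradient (\<phi> W) k"
  by (simp add: lpl_change_def gradient_cross_entropy_compose[OF assms] param_gradient_eq[OF assms])

text \<open>The chain rule puts the Hessian to the left of \<open>jacobian\<close>; transposing
  reverses the product, and symmetry absorbs the transpose of the Hessian.\<close>

lemma cross_derivative_eq: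
  fixes \<phi> :: "real ^ 'p \<Rightarrow> real ^ 'c"
  assumes "\<phi> differentiable (at W)"
  shows "cross_derivative \<phi> k W = logit_jacobian \<phi> W ** logit_hessian (\<phi> W) k"
proof -
  let ?A = "logit_hessian (\<phi> W) k ** jacobian \<phi> (at W)"
  have "(\<phi> has_derivative (\<lambda>h. jacobian \<phi> (at W) *v h)) (at W)"
    using assms by (simp add: jacobian_works)
  then have "((\<lambda>V. logit_gradient (\<phi> V) k) has_derivative (\<lambda>h. ?A *v h)) (at W)"
    using has_derivative_compose[OF _ has_derivative_logit_gradient]
    by (fastforce simp: logit_hessian_mult_vec simp flip: matrix_vector_mul_assoc)
  then have "jacobian (\<lambda>V. logit_gradient (\<phi> V) k) (at W) = ?A"
    by (simp add: jacobian_def flip: frechet_derivative_at)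
  then show ?thesis
    by (simp add: cross_derivative_def logit_jacobian_def matrix_transpose_mul
        transpose_logit_hessian)
qed

text \<open>With \<open>W\<close> fixed, \<open>J\<close> is a constant linear map and
  \<open>lpl_change\<close> is exactly the increment of \<open>J *v logit_gradient v k\<close> from
  \<open>v = \<phi> W\<close>; differentiability there is the claim.\<close>

lemma lpl_change_first_order:
  fixes \<phi> :: "real ^ 'p \<Rightarrow> real ^ 'c"
  assumes "\<phi> differentiable (at W)"
  shows "(\<lambda>\<delta>. norm (lpl_change \<phi> k W \<delta> - logit_jacobian \<phi> W *v lpl_induced (\<phi> W) k \<delta>))
    \<in> o[at 0](\<lambda>\<delta>. norm \<delta>)"
proof (rule smalloI_tendsto)
  let ?J = "logit_jacobian \<phi> W"
  have "((\<lambda>v. ?J *v logit_gradient v k) has_derivative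
      (\<lambda>h. ?J *v lpl_induced (\<phi> W) k h)) (at (\<phi> W))"
    unfolding lpl_induced_def logit_hessian_mult_vec
    by (intro bounded_linear.has_derivative[OF matrix_vector_mul_bounded_linear]
        has_derivative_logit_gradient)
  then show "((\<lambda>\<delta>. norm (lpl_change \<phi> k W \<delta> - ?J *v lpl_induced (\<phi> W) k \<delta>) / norm \<delta>) \<longlongrightarrow> 0) (at 0)"
    by (simp add: has_derivative_at lpl_change_eq[OF assms])
  show "\<forall>\<^sub>F \<delta> in at (0 :: real ^ 'c). norm \<delta> \<noteq> 0"
    by (simp add: eventually_at_filter)
qed

text \<open>By linearity the unperturbed part \<open>J *v h\<close> splits off and cancels against
  the parameter gradient, so there is no remainder term.\<close>

lemma lpg_change_eq:
  fixes f :: "'x \<Rightarrow> real ^ 'p \<Rightarrow> real ^ 'c"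
  assumes "f (x i) differentiable (at W)"
  shows "lpg_change f x y W \<Delta> i = logit_jacobian (f (x i)) W *v \<Delta> (y i)"
  by (simp add: lpg_change_def lpg_logit_gradient_def param_gradient_eq[OF assms]
      matrix_vector_right_distrib)

text \<open>The induced vector depends on the logits of the sample, hence the comparison with LPG is
  made at a single sample and constrains a family only at its class \<open>c\<close>.\<close>

theorem proposition1:
  fixes f :: "'x \<Rightarrow> real ^ 'p \<Rightarrow> real ^ 'c"
    and x :: "'i \<Rightarrow> 'x"
    and y :: "'i \<Rightarrow> 'c"
    and I :: "'i set"
    and W :: "real ^ 'p"
    and i :: 'i
    and c :: 'c
  assumes "finite I"
    and "i \<in> class_samples I y c"
    and "f (x i) differentiable (at W)"
  shows
    "((\<lambda>\<delta>. norm (lpl_change (f (x i)) c W \<delta> - cross_derivative (f (x i)) c W *v \<delta>))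
       \<in> o[at 0](\<lambda>\<delta>. norm \<delta>)) \<and>
     (cross_derivative (f (x i)) c W =
       logit_jacobian (f (x i)) W ** logit_hessian (f (x i) W) c) \<and>
     ((\<lambda>\<delta>. norm (lpl_change (f (x i)) c W \<delta>
                 - logit_jacobian (f (x i)) W *v lpl_induced (f (x i) W) c \<delta>))
       \<in> o[at 0](\<lambda>\<delta>. norm \<delta>)) \<and>
     (\<forall>\<Delta> :: 'c \<Rightarrow> real ^ 'c. lpg_change f x y W \<Delta> i = logit_jacobian (f (x i)) W *v \<Delta> c) \<and>
     (\<forall>\<Delta> :: real ^ 'c \<Rightarrow> 'c \<Rightarrow> real ^ 'c.
       (\<forall>\<delta>. \<Delta> \<delta> c = lpl_induced (f (x i) W) c \<delta>) \<longrightarrow>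
       (\<lambda>\<delta>. norm (lpl_change (f (x i)) c W \<delta> - lpg_change f x y W (\<Delta> \<delta>) i))
         \<in> o[at 0](\<lambda>\<delta>. norm \<delta>)) \<and>
     (range (\<lambda>\<delta>. cross_derivative (f (x i)) c W *v \<delta>)
       \<subseteq> range (\<lambda>\<Delta> :: 'c \<Rightarrow> real ^ 'c. lpg_change f x y W \<Delta> i)) \<and>
     (range (lpl_induced (f (x i) W) c) \<subset> (UNIV :: (real ^ 'c) set))"
proof -
  let ?J = "logit_jacobian (f (x i)) W" and ?H = "lpl_induced (f (x i) W) c"
  have c: "y i = c"
    using assms(2) by (simp add: class_samples_def)
  \<comment> \<open>This reduces both first-order claims to the same estimate.\<close>
  have cross: "cross_derivative (f (x i)) c W *v \<delta> = ?J *v ?H \<delta>" for \<delta>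
    by (simp add: cross_derivative_eq[OF assms(3)] lpl_induced_def matrix_vector_mul_assoc)
  have lpg: "lpg_change f x y W \<Delta> i = ?J *v \<Delta> c" for \<Delta>
    using lpg_change_eq[of f x i, OF assms(3)] c by simp
  \<comment> \<open>The witness assigns the induced vector \<open>?H \<delta>\<close> to every
    class.\<close>
  have "cross_derivative (f (x i)) c W *v \<delta> \<in> range (\<lambda>\<Delta>. lpg_change f x y W \<Delta> i)" for \<delta>
    unfolding cross lpg by (rule range_eqI[where x = "\<lambda>_. ?H \<delta>"]) simp
  then have "range (\<lambda>\<delta>. ?J *v ?H \<delta>) \<subseteq> range (\<lambda>\<Delta>. ?J *v \<Delta> c)"
    unfolding cross lpg by blast
  then show ?thesis
    unfolding cross lpg
    using lpl_change_first_order[OF assms(3), of c] cross_derivative_eq[OF assms(3), of c]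
      lpl_induced_range[of "f (x i) W" c]
    by (intro conjI allI impI) (simp_all only:)
qed

end
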